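(* For all integers $n\ge 2$ and $1\le d\le n-1$, the polynomial $$g_{n,d}(t)=\sum_{i=1}^{\min(d,n-d)} \frac{(n-i-1)!}{(d-i)!\,(n-d-i)!\,(i-1)!}\, t^i$$ has only real zeros.
   Context: $g_{n,d}(t)$ is Speyer's $g$-polynomial of the uniform matroid $U_{n,d}$ of rank $d$ on $n$ elements; in this statement it is simply the explicit polynomial displayed. *)

theory Defs
  imports Complex_Main "HOL-Computational_Algebra.Polynomial"
begin

text \<open>
  For \<open>1 \<le> d \<le> n - 1\<close> no subtraction below truncates: \<open>i \<le> min d (n - d)\<close> gives
  \<open>i \<le> d\<close>, \<open>i \<le> n - d\<close> and \<open>i + 1 \<le> n\<close>.
\<close>

definition g_poly :: "nat \<Rightarrow> nat \<Rightarrow> real poly" where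
  "g_poly n d =
     (\<Sum>i = 1..min d (n - d).
        monom (fact (n - i - 1) / (fact (d - i) * fact (n - d - i) * fact (i - 1))) i)"

definition only_real_zeros :: "real poly \<Rightarrow> bool" where
  "only_real_zeros p \<longleftrightarrow>
     (\<forall>z :: complex. poly (map_poly complex_of_real p) z = 0 \<longrightarrow> z \<in> \<real>)"

end

theory Submission
  imports Defs "HOL-Computational_Algebra.Fundamental_Theorem_Algebra"
begin

text \<open>
  With \<open>a = d - 1\<close> and \<open>b = n - d - 1\<close>, the \<open>a\<close>-th derivative of \<open>s\<^sup>b (1 + s)\<^sup>a\<close> equals
  \<open>a! s\<^sup>b\<^sup>+\<^sup>1 g(1/s)\<close>. The polynomial \<open>s\<^sup>b (1 + s)\<^sup>a\<close> has only real zeros, and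
  differentiation preserves this property as long as the degree is positive: off the real axis,
  the logarithmic derivative \<open>\<Sum> 1/(z - x)\<close> over the real zeros \<open>x\<close> has an imaginary part of
  sign opposite to that of \<open>z\<close>, hence does not vanish.
\<close>

text \<open>By the product rule, adjoining the factor \<open>[:-x, 1:]\<close> adds
  \<open>1 / (z - x)\<close> to the logarithmic derivative at \<open>z\<close>. The multiset
  \<open>A\<close> records zeros with multiplicity.\<close>

lemma poly_pderiv_prod_mset_linear:
  fixes z :: "'a :: field_char_0"
  assumes "z \<notin># A"
  shows "poly (pderiv (\<Prod>x\<in>#A. [:-x, 1:])) z =
           poly (\<Prod>x\<in>#A. [:-x, 1:]) z * (\<Sum>x\<in>#A. 1 / (z - x))"
  using assms
proof (induction A)
  case (add x A)
  have pderiv_step: "poly (pderiv ([:-x, 1:] * q)) z = poly q z + (z - x) * poly (pderiv q) z" for q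
    by (simp only: pderiv_mult) (simp add: pderiv_pCons algebra_simps)
  define q where "q = (\<Prod>x\<in>#A. [:-x, 1:])"
  define S where "S = (\<Sum>x\<in>#A. 1 / (z - x))"
  have "z - x \<noteq> 0" using add.prems by auto
  moreover have "poly (pderiv q) z = poly q z * S"
    using add by (simp add: q_def S_def)
  ultimately have "poly (pderiv ([:-x, 1:] * q)) z = (z - x) * poly q z * (1 / (z - x) + S)"
    by (simp only: pderiv_step) (simp add: distrib_left)
  also have "(z - x) * poly q z = poly ([:-x, 1:] * q) z"
    by (simp add: algebra_simps)
  finally show ?case
    by (simp only: q_def S_def image_mset_add_mset prod_mset.add_mset sum_mset.add_mset)
qed simp

text \<open>For real \<open>x\<close> the imaginary part of \<open>1 / (z - x)\<close> is
  \<open>- Im z / |z - x|^2\<close>, so the terms cannot cancel. The factor \<open>Im z\<close>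
  treats both half-planes at once.\<close>

lemma Im_sum_mset_inverse_diff_reals:
  fixes z :: complex
  assumes "\<And>x. x \<in># A \<Longrightarrow> x \<in> \<real>" and "z \<notin> \<real>" and "A \<noteq> {#}"
  shows "Im z * Im (\<Sum>x\<in>#A. 1 / (z - x)) < 0"
  using assms
proof (induction A)
  case (add x A)
  have z: "Im z \<noteq> 0" using add.prems by (simp add: complex_is_Real_iff)
  have x: "Im x = 0" using add.prems(1)[of x] by (simp add: complex_is_Real_iff)
  have "Im z * Im (1 / (z - x)) = - ((Im z)\<^sup>2 / ((Re z - Re x)\<^sup>2 + (Im z)\<^sup>2))"
    using x by (simp add: Im_divide power2_eq_square)
  also have "\<dots> < 0"
    using z by (simp add: divide_pos_pos sum_power2_gt_zero_iff)
  finally have "Im z * Im (1 / (z - x)) < 0" .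
  \<comment> \<open>The inequality is weak because \<open>A\<close> may be empty here, where the sum
    is 0.\<close>
  moreover have "Im z * Im (\<Sum>x\<in>#A. 1 / (z - x)) \<le> 0"
    using add by (cases "A = {#}") (auto intro: less_imp_le)
  ultimately show ?case by (simp add: distrib_left)
qed simp

text \<open>The Gauss-Lucas argument for the real line. Positive degree excludes constants, whose
  derivative vanishes everywhere.\<close>

lemma pderiv_real_roots:
  fixes p :: "complex poly"
  assumes "\<And>z. poly p z = 0 \<Longrightarrow> z \<in> \<real>" and "degree p > 0" and "poly (pderiv p) z = 0"
  shows "z \<in> \<real>"
proof (rule ccontr)
  assume z: "z \<notin> \<real>"
  have p0: "p \<noteq> 0" using assms(2) by auto
  obtain A where A: "size A = degree p" "p = smult (lead_coeff p) (\<Prod>x\<in>#A. [:-x, 1:])"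
    using alg_closed_imp_factorization[OF p0] by blast
  define q where "q = (\<Prod>x\<in>#A. [:-x, 1:])"
  have p: "p = smult (lead_coeff p) q" using A(2) by (simp add: q_def)
  have poly_p: "poly p w = lead_coeff p * poly q w" for w
    using p by (metis poly_smult)
  have "x \<in> \<real>" if "x \<in># A" for x
  proof (rule assms(1))
    have "poly q x = 0"
      using that by (auto simp: q_def poly_prod_mset image_iff)
    then show "poly p x = 0" by (simp add: poly_p)
  qed
  moreover have "A \<noteq> {#}" using A(1) assms(2) by auto
  ultimately have "Im z * Im (\<Sum>x\<in>#A. 1 / (z - x)) < 0"
    using z by (intro Im_sum_mset_inverse_diff_reals)
  then have "(\<Sum>x\<in>#A. 1 / (z - x)) \<noteq> 0" by auto
  moreover have "poly q z \<noteq> 0"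
    using assms(1)[of z] z by (auto simp: poly_p)
  moreover have "z \<notin># A" using \<open>\<And>x. x \<in># A \<Longrightarrow> x \<in> \<real>\<close> z by blast
  ultimately have "poly (pderiv q) z \<noteq> 0"
    by (simp add: poly_pderiv_prod_mset_linear q_def)
  moreover have "poly (pderiv p) z = lead_coeff p * poly (pderiv q) z"
    using p by (metis pderiv_smult poly_smult)
  ultimately show False
    using assms(3) p0 by simp
qed

text \<open>Each differentiation lowers the degree by one, so \<open>k \<le> degree p\<close> keeps
  every polynomial that gets differentiated nonconstant.\<close>

lemma higher_pderiv_real_roots:
  fixes p :: "complex poly"
  assumes "\<And>z. poly p z = 0 \<Longrightarrow> z \<in> \<real>" and "k \<le> degree p" and "poly ((pderiv ^^ k) p) z = 0"
  shows "z \<in> \<real>"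
  using assms(2,3)
proof (induction k arbitrary: z)
  case (Suc k)
  have "z \<in> \<real>" if "poly ((pderiv ^^ k) p) z = 0" for z
    using Suc that by simp
  moreover have "degree ((pderiv ^^ k) p) > 0"
    using Suc.prems(1) by (simp add: degree_higher_pderiv)
  ultimately show ?case
    using Suc.prems(2) pderiv_real_roots[of "(pderiv ^^ k) p"] by simp
qed (use assms(1) in simp)

text \<open>The coefficient of \<open>s^(b - j)\<close> comes from the term
  \<open>s^(a + b - j)\<close>, with binomial coefficient \<open>a choose (a - j)\<close>;
  \<open>a\<close> differentiations multiply it by \<open>(a + b - j)! / (b - j)!\<close>.\<close>

lemma coeff_higher_pderiv_monom_mult_binomial:
  assumes "j \<le> b"
  shows "coeff ((pderiv ^^ a) (monom 1 b * [:1, 1:] ^ a)) (b - j) =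
           (if j \<le> a then fact a * fact (a + b - j) / (fact (a - j) * fact (b - j) * fact j)
            else (0 :: 'a :: field_char_0))"
proof (cases "j \<le> a")
  case True
  have "pochhammer (of_nat (Suc (b - j))) a * fact (b - j) = (fact (a + b - j) :: 'a)"
    using pochhammer_product'[of "1::'a" "b - j" a] assms
    by (simp add: pochhammer_fact add.commute mult.commute)
  then have "pochhammer (of_nat (Suc (b - j))) a = (fact (a + b - j) / fact (b - j) :: 'a)"
    by (simp add: nonzero_eq_divide_eq)
  moreover have "of_nat (a choose (a - j)) = (fact a / (fact (a - j) * fact j) :: 'a)"
    using True by (simp add: binomial_fact)
  moreover have "b - j + a = b + (a - j)"
    using True assms by simp
  ultimately have "coeff ((pderiv ^^ a) (monom 1 b * [:1, 1:] ^ a)) (b - j) =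
      (fact (a + b - j) / fact (b - j)) * (fact a / (fact (a - j) * fact j) :: 'a)"
    by (simp only: coeff_higher_pderiv coeff_monom_mult) (simp add: coeff_linear_poly_power)
  then show ?thesis
    using True by (simp add: mult_ac)
next
  \<comment> \<open>Here \<open>a + b - j < b\<close>, while every term of the product is divisible
    by \<open>s^b\<close>.\<close>
  case False
  then show ?thesis
    using assms by (simp add: coeff_higher_pderiv coeff_monom_mult)
qed

lemma degree_monom_mult_binomial:
  "degree (monom 1 b * [:1, 1:] ^ a :: 'a :: field_char_0 poly) = a + b"
  by (simp add: degree_mult_eq degree_monom_eq degree_power_eq)

lemma map_poly_of_real_sum:
  "map_poly of_real (\<Sum>i\<in>A. f i) =
     (\<Sum>i\<in>A. map_poly (of_real :: real \<Rightarrow> 'a :: real_algebra_1) (f i))"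
  by (rule poly_eqI) (simp add: coeff_map_poly coeff_sum)

text \<open>The substitution \<open>1 / z\<close> reverses the coefficients: the term at
  \<open>b - j\<close> becomes the one at \<open>i = j + 1\<close>, where
  \<open>n - i - 1 = a + b - j\<close>, \<open>d - i = a - j\<close> and
  \<open>n - d - i = b - j\<close>.\<close>

lemma g_poly_eq_higher_pderiv:
  fixes z :: complex
  assumes "z \<noteq> 0"
  shows "fact a * poly (map_poly of_real (g_poly (a + b + 2) (a + 1))) z =
           z ^ (b + 1) * poly ((pderiv ^^ a) (monom 1 b * [:1, 1:] ^ a)) (1 / z)"
proof -
  define D :: "complex poly" where "D = (pderiv ^^ a) (monom 1 b * [:1, 1:] ^ a)"
  define c :: "nat \<Rightarrow> complex" where
    "c j = fact (a + b - j) / (fact (a - j) * fact (b - j) * fact j)" for j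
  have "degree D = b"
    by (simp add: D_def degree_higher_pderiv degree_monom_mult_binomial)
  then have "poly D (1 / z) = (\<Sum>k\<le>b. coeff D k * (1 / z) ^ k)"
    by (simp add: poly_altdef)
  also have "\<dots> = (\<Sum>j\<le>b. coeff D (b - j) * (1 / z) ^ (b - j))"
    by (rule sum.reindex_bij_witness[of _ "\<lambda>j. b - j" "\<lambda>j. b - j"]) auto
  finally have "z ^ (b + 1) * poly D (1 / z) =
      (\<Sum>j\<le>b. z ^ (b + 1) * (coeff D (b - j) * (1 / z) ^ (b - j)))"
    by (simp add: sum_distrib_left)
  also have "\<dots> = (\<Sum>j\<le>b. coeff D (b - j) * z ^ (j + 1))"
  proof (rule sum.cong)
    fix j assume "j \<in> {..b}"
    then have "z ^ (b + 1) = z ^ (j + 1) * z ^ (b - j)"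
      by (simp flip: power_add)
    then show "z ^ (b + 1) * (coeff D (b - j) * (1 / z) ^ (b - j)) = coeff D (b - j) * z ^ (j + 1)"
      using assms by (simp add: power_divide)
  qed simp
  \<comment> \<open>The coefficients with \<open>a < j \<le> b\<close> vanish.\<close>
  also have "\<dots> = (\<Sum>j\<le>min a b. fact a * (c j * z ^ (j + 1)))"
    by (rule sum.mono_neutral_cong_right)
       (auto simp: D_def c_def coeff_higher_pderiv_monom_mult_binomial)
  also have "\<dots> = fact a * (\<Sum>i = 1..min a b + 1. c (i - 1) * z ^ i)"
    unfolding sum_distrib_left
    by (rule sum.reindex_bij_witness[of _ "\<lambda>i. i - 1" "\<lambda>j. j + 1"]) auto
  also have "(\<Sum>i = 1..min a b + 1. c (i - 1) * z ^ i) =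
      poly (map_poly of_real (g_poly (a + b + 2) (a + 1))) z"
  proof -
    have "poly (map_poly of_real (g_poly (a + b + 2) (a + 1))) z =
      (\<Sum>i = 1..min (a + 1) (b + 1).
         complex_of_real (fact (a + b + 1 - i) /
           (fact (a + 1 - i) * fact (b + 1 - i) * fact (i - 1))) * z ^ i)"
      by (simp add: g_poly_def map_poly_of_real_sum map_poly_monom poly_sum poly_monom
          del: sum.cl_ivl_Suc)
    also have "\<dots> = (\<Sum>i = 1..min a b + 1. c (i - 1) * z ^ i)"
      by (rule sum.cong) (auto simp: c_def Suc_diff_le)
    finally show ?thesis ..
  qed
  finally show ?thesis by (simp add: D_def)
qed

theorem theorem3p1:
  fixes n d :: nat
  assumes "n \<ge> 2" and "1 \<le> d" and "d \<le> n - 1"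
  shows "only_real_zeros (g_poly n d)"
  unfolding only_real_zeros_def
proof (intro allI impI)
  fix z :: complex
  assume root: "poly (map_poly complex_of_real (g_poly n d)) z = 0"
  define a where "a = d - 1"
  define b where "b = n - d - 1"
  define Q :: "complex poly" where "Q = monom 1 b * [:1, 1:] ^ a"
  have nd: "n = a + b + 2" "d = a + 1"
    using assms by (auto simp: a_def b_def)
  show "z \<in> \<real>"
  \<comment> \<open>The point 0 is always a zero of \<open>g_poly n d\<close>, and it is real; any
    other zero can be inverted.\<close>
  proof (cases "z = 0")
    case False
    \<comment> \<open>The factor \<open>z ^ (b + 1)\<close> in the identity is nonzero and
      cancels.\<close>
    have "poly ((pderiv ^^ a) Q) (1 / z) = 0"
      using g_poly_eq_higher_pderiv[OF False, of a b] root False by (simp add: nd Q_def)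
    moreover have "x \<in> \<real>" if "poly Q x = 0" for x
    proof -
      from that have "x = 0 \<or> x = -1"
        by (auto simp: Q_def poly_monom add_eq_0_iff)
      then show ?thesis by auto
    qed
    moreover have "a \<le> degree Q"
      by (simp add: Q_def degree_monom_mult_binomial)
    ultimately have "1 / z \<in> \<real>"
      using higher_pderiv_real_roots by blast
    then have "inverse (1 / z) \<in> \<real>" by (rule Reals_inverse)
    then show ?thesis by simp
  qed simp
qed

end
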